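(* Let $r\ge 1$ and $k$ be integers, and write $k=(2r+1)p+q$ with $p\ge 1$ an integer and $q\in\{0,1,\dots,2r\}$. Let $C_{2k+1}$ be the cycle on $2k+1$ vertices. Then: (a) if $\gcd(2r+1,2k+1)\neq 1$, then $M_r^I(C_{2k+1})=\gcd(2r+1,2k+1)\left\lceil \frac{2k+1}{2\gcd(2r+1,2k+1)}\right\rceil$; (b) if $\gcd(2r+1,2k+1)=1$ and $q\in\{0,2r\}$, then $M_r^I(C_{2k+1})=k+2$; (c) in all other cases, $M_r^I(C_{2k+1})=k+1$.
   Context: For a graph $G=(V,E)$ and integer $r\ge1$, $d(x,y)$ is the number of edges in a shortest path between $x$ and $y$, $N_r[x]=\{y\in V: d(x,y)\le r\}$, and for $D\subseteq V$, $D_r(x)=N_r[x]\cap D$. A set $D\subseteq V$ is an $r$-identifying code ($r$-IC) of $G$ if $D_r(x)\neq\emptyset$ for every $x\in V$ and $D_r(x)\neq D_r(y)$ for all distinct $x,y\in V$. $M_r^I(G)$ denotes the minimum cardinality of an $r$-identifying code of $G$. *)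

theory Defs
  imports Complex_Main "Graph_Theory.Graph_Theory"
begin

text \<open>
  Undirected graphs are symmetric digraphs, an edge being a pair of opposite arcs
  (locale \<^locale>\<open>graph\<close>). With unit weights the cost of a walk is its number of arcs, so
  \<open>wf_digraph.\<mu> G (\<lambda>_. 1) x y\<close> is the number of edges of a shortest path between \<open>x\<close> and \<open>y\<close>,
  and \<open>\<infinity>\<close> if there is none. The definitions below are meant for \<open>graph G\<close> only.
\<close>

definition graph_dist :: "('a, 'b) pre_digraph \<Rightarrow> 'a \<Rightarrow> 'a \<Rightarrow> ereal" where
  "graph_dist G x y = wf_digraph.\<mu> G (\<lambda>_. 1) x y"

definition closed_nbhd :: "('a, 'b) pre_digraph \<Rightarrow> nat \<Rightarrow> 'a \<Rightarrow> 'a set" where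
  "closed_nbhd G r x = {y \<in> verts G. graph_dist G x y \<le> ereal (real r)}"

definition identifying_code :: "('a, 'b) pre_digraph \<Rightarrow> nat \<Rightarrow> 'a set \<Rightarrow> bool" where
  "identifying_code G r D \<longleftrightarrow>
     D \<subseteq> verts G \<and>
     (\<forall>x \<in> verts G. closed_nbhd G r x \<inter> D \<noteq> {}) \<and>
     (\<forall>x \<in> verts G. \<forall>y \<in> verts G. x \<noteq> y \<longrightarrow>
        closed_nbhd G r x \<inter> D \<noteq> closed_nbhd G r y \<inter> D)"

text \<open>Unspecified if there is no finite \<open>r\<close>-identifying code.\<close>

definition min_identifying_code :: "('a, 'b) pre_digraph \<Rightarrow> nat \<Rightarrow> nat" where
  "min_identifying_code G r = (LEAST m. \<exists>D. identifying_code G r D \<and> finite D \<and> card D = m)"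

text \<open>The cycle on \<open>n\<close> vertices, meant for \<open>n \<ge> 3\<close>.\<close>

definition cycle_graph :: "nat \<Rightarrow> nat pair_pre_digraph" where
  "cycle_graph n = \<lparr> pverts = {..<n},
     parcs = {(u, v). u < n \<and> v < n \<and> (v = (u + 1) mod n \<or> u = (v + 1) mod n)} \<rparr>"

lemma pair_graph_cycle_graph:
  assumes "n \<ge> 3"
  shows "pair_graph (cycle_graph n)"
proof -
  have fin: "finite (parcs (cycle_graph n))"
    by (rule finite_subset[of _ "{..<n} \<times> {..<n}"]) (auto simp: cycle_graph_def)
  have loop: "(u + 1) mod n \<noteq> u" if "u < n" for u
    using assms that by (cases "u + 1 = n") auto
  show ?thesis
    by unfold_locales
      (use fin loop in \<open>force simp: cycle_graph_def symmetric_def intro!: symI\<close>)+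
qed

end

theory Submission
  imports Defs
begin

text \<open>
  Put \<open>n = 2k + 1\<close> and \<open>s = 2r + 1\<close>. Comparing the neighbourhoods of consecutive vertices shows that
  a set of residues modulo \<open>n\<close> is a code iff it meets every window of \<open>s\<close> consecutive residues and
  contains \<open>x\<close> or \<open>x + s\<close> for every \<open>x\<close>, i.e. is a vertex cover of the graph with edges \<open>{x, x + s}\<close>.
  That graph consists of \<open>g = gcd s n\<close> odd cycles, whence the lower bound \<open>g (n/g + 1)/2\<close>. For \<open>g \<ge> 3\<close>
  the alternating covers of three neighbouring cycles can be shifted against each other so that no
  window is missed. For \<open>g = 1\<close> a minimum cover alternates along the single cycle and is unique up to
  rotation; indexing residues by \<open>x \<mapsto> s\<inverse> x\<close>, a missed window would have only odd indices, which
  advance by a constant even step \<open>\<delta>\<close> with \<open>s \<delta> = n + 1\<close> or \<open>s \<delta> = 1 - n\<close>, and this happens exactly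
  for \<open>q = 2r\<close> and \<open>q = 0\<close>. In those cases switching the parity on a short interval of indices repairs
  the cover at the cost of one more element.
\<close>

section \<open>Walks and balls in the cycle\<close>

lemma pverts_cycle_graph: "pverts (cycle_graph n) = {..<n}"
  by (simp add: cycle_graph_def)

text \<open>Over the integers both directions of an edge become a step of +1 or -1 from
  \<open>u\<close>, so that displacements can be added along walks.\<close>

lemma cycle_graph_arc_iff:
  "(u, v) \<in> parcs (cycle_graph n) \<longleftrightarrow> u < n \<and> v < n \<and>
     (int v = (int u + 1) mod int n \<or> int v = (int u - 1) mod int n)"
proof -
  have "v = (u + 1) mod n \<longleftrightarrow> int v = (int u + 1) mod int n"
    by (metis of_nat_1 of_nat_add of_nat_eq_iff zmod_int)
  moreover have "u = (v + 1) mod n \<longleftrightarrow> int v = (int u - 1) mod int n" if "u < n" "v < n"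
  proof -
    have "u = (v + 1) mod n \<longleftrightarrow> int u mod int n = (int v + 1) mod int n"
      using that by (metis of_nat_1 of_nat_add of_nat_eq_iff zmod_int mod_less)
    also have "\<dots> \<longleftrightarrow> int v mod int n = (int u - 1) mod int n"
      by (auto simp: mod_eq_dvd_iff dvd_diff_commute algebra_simps)
    finally show ?thesis using that by (simp flip: of_nat_mod)
  qed
  ultimately show ?thesis by (auto simp: cycle_graph_def)
qed

context
  fixes n :: nat
  assumes n3: "n \<ge> 3"
begin

interpretation C: pair_graph "cycle_graph n"
  using n3 by (rule pair_graph_cycle_graph)

lemma cycle_walk_displacement:
  assumes "C.awalk x es y"
  shows "\<exists>t. \<bar>t\<bar> \<le> int (length es) \<and> int y = (int x + t) mod int n"
  using assms
proof (induction es arbitrary: x)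
  case Nil
  then have "x = y" "y < n" by (auto simp: C.awalk_Nil_iff pverts_cycle_graph)
  then show ?case by (intro exI[of _ 0]) simp
next
  case (Cons e es)
  from Cons.prems have e: "(x, snd e) \<in> parcs (cycle_graph n)" and w: "C.awalk (snd e) es y"
    by (auto simp: C.awalk_Cons_iff)
  from Cons.IH[OF w] obtain t where t: "\<bar>t\<bar> \<le> int (length es)" "int y = (int (snd e) + t) mod int n"
    by blast
  from e obtain d where d: "\<bar>d\<bar> \<le> (1::int)" "int (snd e) = (int x + d) mod int n"
    unfolding cycle_graph_arc_iff
    by (metis abs_1 abs_minus_cancel order_refl diff_conv_add_uminus)
  have "int y = (int x + (d + t)) mod int n"
    using t(2) d(2) by (simp add: mod_simps add.assoc)
  moreover have "\<bar>d + t\<bar> \<le> int (length (e # es))" using t d by simp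
  ultimately show ?case by blast
qed

lemma cycle_walk_exists:
  assumes "x < n" "\<sigma> = 1 \<or> \<sigma> = - 1"
  shows "\<exists>es. length es = m \<and> C.awalk x es (nat ((int x + \<sigma> * int m) mod int n))"
  using assms(1)
proof (induction m arbitrary: x)
  case 0
  then show ?case by (auto simp: C.awalk_Nil_iff pverts_cycle_graph)
next
  case (Suc m)
  define x' where "x' = nat ((int x + \<sigma>) mod int n)"
  have x': "int x' = (int x + \<sigma>) mod int n" "x' < n"
    using n3 by (auto simp: x'_def nat_less_iff)
  obtain es where es: "length es = m" "C.awalk x' es (nat ((int x' + \<sigma> * int m) mod int n))"
    using Suc.IH[OF x'(2)] by blast
  have "(x, x') \<in> parcs (cycle_graph n)"
    using Suc.prems assms(2) x' by (auto simp: cycle_graph_arc_iff)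
  moreover have "(int x' + \<sigma> * int m) mod int n = (int x + \<sigma> * int (Suc m)) mod int n"
    by (simp add: x' mod_simps algebra_simps)
  ultimately have "C.awalk x ((x, x') # es) (nat ((int x + \<sigma> * int (Suc m)) mod int n))"
    using es by (simp add: C.awalk_Cons_iff)
  with es show ?case by (metis length_Cons)
qed

lemma closed_nbhd_cycle_iff:
  assumes "x < n"
  shows "y \<in> closed_nbhd (cycle_graph n) r x \<longleftrightarrow>
    (\<exists>t. \<bar>t\<bar> \<le> int r \<and> int y = (int x + t) mod int n)"
proof
  assume "y \<in> closed_nbhd (cycle_graph n) r x"
  then have "C.\<mu> (\<lambda>_. 1) x y \<le> ereal (real r)"
    by (simp add: closed_nbhd_def graph_dist_def)
  \<comment> \<open>\<open>\<mu>\<close> is an infimum; the strict bound by \<open>r + 1\<close>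
    yields an actual walk, and as its cost is a whole number, its length is at most
    \<open>r\<close>.\<close>
  also have "\<dots> < ereal (real r + 1)" by simp
  finally obtain es where es: "C.awalk x es y" "C.awalk_cost (\<lambda>_. 1) es < real r + 1"
    unfolding C.\<mu>_def by (auto simp: Inf_less_iff)
  then have "length es \<le> r" by (simp add: C.awalk_cost_def sum_list_triv)
  with cycle_walk_displacement[OF es(1)] show "\<exists>t. \<bar>t\<bar> \<le> int r \<and> int y = (int x + t) mod int n"
    by force
next
  assume "\<exists>t. \<bar>t\<bar> \<le> int r \<and> int y = (int x + t) mod int n"
  then obtain t where t: "\<bar>t\<bar> \<le> int r" "int y = (int x + t) mod int n" by blast
  have y: "y < n" using t(2) n3 by (metis of_nat_less_iff pos_mod_bound of_nat_0_less_iff less_le_trans zero_less_numeral)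
  have "(if t \<ge> 0 then 1 else - 1) * int (nat \<bar>t\<bar>) = t" by auto
  then obtain es where es: "length es = nat \<bar>t\<bar>" "C.awalk x es y"
    using cycle_walk_exists[OF assms, of "if t \<ge> 0 then 1 else - 1" "nat \<bar>t\<bar>"] t(2)
    by (metis nat_int)
  have "C.\<mu> (\<lambda>_. 1) x y \<le> ereal (C.awalk_cost (\<lambda>_. 1) es)"
    using C.min_cost_le_walk_cost[OF es(2)] .
  also have "\<dots> \<le> ereal (real r)"
    using es(1) t(1) by (simp add: C.awalk_cost_def sum_list_triv)
  finally show "y \<in> closed_nbhd (cycle_graph n) r x"
    using y by (simp add: closed_nbhd_def graph_dist_def pverts_cycle_graph)
qed

end

section \<open>Codes as sets of residues\<close>

text \<open>With \<open>s = 2r + 1\<close> the window from \<open>x\<close> is the ball about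
  \<open>x + r\<close>, while \<open>x\<close> and \<open>x + s\<close> are the residues by which
  the balls about \<open>x + r\<close> and \<open>x + r + 1\<close> differ. Letting \<open>x\<close>
  run over all integers avoids separate cases for wraparound.\<close>

definition circular_code :: "int \<Rightarrow> int \<Rightarrow> int set \<Rightarrow> bool" where
  "circular_code n s S \<longleftrightarrow> S \<subseteq> {0..<n} \<and>
     (\<forall>x. \<exists>i\<in>{0..<s}. (x + i) mod n \<in> S) \<and>
     (\<forall>x. x mod n \<in> S \<or> (x + s) mod n \<in> S)"

text \<open>Separating consecutive vertices suffices: for vertices farther apart either the balls
  are disjoint and domination separates them, or one of \<open>x - r\<close>,
  \<open>x + r + 1\<close> tells them apart. The bound on \<open>n\<close> keeps the balls from
  meeting again round the back of the cycle.\<close>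

lemma identifying_code_cycle_iff:
  assumes n: "n \<ge> 4 * r + 3"
  shows "identifying_code (cycle_graph n) r D \<longleftrightarrow>
    circular_code (int n) (2 * int r + 1) (int ` D)"
proof
  define N where "N x = {y. \<exists>t. \<bar>t\<bar> \<le> int r \<and> y = (x + t) mod int n}" for x
  have n3: "n \<ge> 3" and n0: "int n > 0" using n by simp_all
  have N: "int ` (closed_nbhd (cycle_graph n) r x \<inter> D) = N (int x) \<inter> int ` D" if "x < n" for x
    using closed_nbhd_cycle_iff[OF n3 that, of _ r] by (auto simp: N_def)
  note verts = with_proj_simps(1) pverts_cycle_graph
  have N_mod: "N (x mod int n) = N x" for x by (simp add: N_def mod_simps)
  {
    assume ic: "identifying_code (cycle_graph n) r D"
    then have sub: "int ` D \<subseteq> {0..<int n}" by (auto simp: identifying_code_def verts)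
    have dom: "N x \<inter> int ` D \<noteq> {}" for x
    proof -
      have "nat (x mod int n) < n" using n0 by (simp add: nat_less_iff)
      with ic N[OF this] show ?thesis
        using n0 by (fastforce simp: identifying_code_def verts N_mod)
    qed
    have sep: "N x \<inter> int ` D \<noteq> N y \<inter> int ` D" if "x mod int n \<noteq> y mod int n" for x y
    proof -
      have *: "nat (x mod int n) < n" "nat (y mod int n) < n" using n0 by (simp_all add: nat_less_iff)
      have "nat (x mod int n) \<noteq> nat (y mod int n)" using that n0 by (simp add: eq_nat_nat_iff)
      with ic * have "closed_nbhd (cycle_graph n) r (nat (x mod int n)) \<inter> D \<noteq>
          closed_nbhd (cycle_graph n) r (nat (y mod int n)) \<inter> D"
        by (simp add: identifying_code_def verts)
      then have "int ` (closed_nbhd (cycle_graph n) r (nat (x mod int n)) \<inter> D) \<noteq>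
          int ` (closed_nbhd (cycle_graph n) r (nat (y mod int n)) \<inter> D)"
        by (simp add: inj_image_eq_iff)
      then show ?thesis using N[OF *(1)] N[OF *(2)] n0 by (simp add: N_mod)
    qed
    show "circular_code (int n) (2 * int r + 1) (int ` D)"
      unfolding circular_code_def
    proof (intro conjI allI sub)
      fix x
      obtain y where y: "y \<in> N (x + int r)" "y \<in> int ` D" using dom by blast
      then obtain t where "\<bar>t\<bar> \<le> int r" "y = (x + int r + t) mod int n" by (auto simp: N_def)
      then show "\<exists>i\<in>{0..<2 * int r + 1}. (x + i) mod int n \<in> int ` D"
        using y(2) by (intro bexI[of _ "int r + t"]) (auto simp: add.assoc)
    next
      fix x
      show "x mod int n \<in> int ` D \<or> (x + (2 * int r + 1)) mod int n \<in> int ` D"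
      proof (rule ccontr)
        assume no: "\<not> ?thesis"
        let ?y = "x + int r"
        have "?y mod int n \<noteq> (?y + 1) mod int n"
          using n by (auto simp: mod_eq_dvd_iff)
        from sep[OF this] have "N ?y \<inter> int ` D \<noteq> N (?y + 1) \<inter> int ` D" .
        moreover have "N ?y \<inter> int ` D = N (?y + 1) \<inter> int ` D"
        proof (intro equalityI subsetI; elim IntE)
          fix z assume z: "z \<in> N ?y" "z \<in> int ` D"
          then obtain t where t: "\<bar>t\<bar> \<le> int r" "z = (?y + t) mod int n" by (auto simp: N_def)
          then have "t \<noteq> - int r" using no z by auto
          then have "\<bar>t - 1\<bar> \<le> int r" using t by auto
          moreover have "z = (?y + 1 + (t - 1)) mod int n" using t by (simp add: add.assoc)
          ultimately show "z \<in> N (?y + 1) \<inter> int ` D" using z unfolding N_def by blast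
        next
          fix z assume z: "z \<in> N (?y + 1)" "z \<in> int ` D"
          then obtain t where t: "\<bar>t\<bar> \<le> int r" "z = (?y + 1 + t) mod int n" by (auto simp: N_def)
          then have "t \<noteq> int r" using no z by (auto simp: algebra_simps)
          then have "\<bar>t + 1\<bar> \<le> int r" using t by auto
          moreover have "z = (?y + (t + 1)) mod int n" using t by (simp add: algebra_simps)
          ultimately show "z \<in> N ?y \<inter> int ` D" using z unfolding N_def by blast
        qed
        ultimately show False by blast
      qed
    qed
  }
  {
    assume cc: "circular_code (int n) (2 * int r + 1) (int ` D)"
    have sub: "D \<subseteq> {..<n}" using cc by (force simp: circular_code_def)
    have dom: "\<exists>t. \<bar>t\<bar> \<le> int r \<and> (x + t) mod int n \<in> int ` D" for x
    proof -
      obtain i where "i \<in> {0..<2 * int r + 1}" "(x - int r + i) mod int n \<in> int ` D"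
        using cc unfolding circular_code_def by blast
      then show ?thesis by (intro exI[of _ "i - int r"]) (auto simp: algebra_simps)
    qed
    \<comment> \<open>\<open>j\<close> is the distance along the shorter way round;
      \<open>sep'\<close> reduces every pair to this case, if necessary by going from
      \<open>y\<close> past \<open>n\<close> to \<open>x\<close>.\<close>
    have sep: "N x \<inter> int ` D \<noteq> N (x + j) \<inter> int ` D" if j: "0 < j" "2 * j \<le> int n" for x j
    proof -
      have notin: "(x + a) mod int n \<notin> N (x + b)" if "\<And>t. \<bar>t\<bar> \<le> int r \<Longrightarrow> 0 < \<bar>a - b - t\<bar> \<and> \<bar>a - b - t\<bar> < int n" for a b
      proof
        assume "(x + a) mod int n \<in> N (x + b)"
        then obtain t where t: "\<bar>t\<bar> \<le> int r" "(x + a) mod int n = (x + (b + t)) mod int n"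
          by (auto simp: N_def add.assoc)
        then have "int n dvd a - b - t" by (simp add: mod_eq_dvd_iff algebra_simps)
        with that[OF t(1)] show False by (metis abs_ge_zero abs_of_nat zdvd_not_zless abs_dvd_iff dvd_abs_iff)
      qed
      show ?thesis
      proof (cases "j \<le> 2 * int r + 1")
        case True
        \<comment> \<open>\<open>x - r\<close> is the first residue of the ball about
          \<open>x\<close>, and \<open>x + r + 1\<close> is the first one beyond it, which for
          \<open>j \<le> 2r + 1\<close> still lies in the ball about \<open>x + j\<close>.\<close>
        have "(x - int r) mod int n \<in> int ` D \<or> (x - int r + (2 * int r + 1)) mod int n \<in> int ` D"
          using cc unfolding circular_code_def by blast
        then show ?thesis
        proof
          assume a: "(x - int r) mod int n \<in> int ` D"
          have "(x - int r) mod int n \<in> N x" by (auto simp: N_def intro!: exI[of _ "- int r"])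
          moreover have "(x + (- int r)) mod int n \<notin> N (x + j)"
            by (rule notin) (use j n in auto)
          ultimately show ?thesis using a by auto
        next
          assume a: "(x - int r + (2 * int r + 1)) mod int n \<in> int ` D"
          have "(x + (int r + 1)) mod int n \<in> N (x + j)"
            using j True by (auto simp: N_def intro!: exI[of _ "int r + 1 - j"])
          moreover have "(x + (int r + 1)) mod int n \<notin> N (x + 0)"
            by (rule notin) (use j n in auto)
          ultimately show ?thesis using a by (auto simp: algebra_simps)
        qed
      next
        case False
        obtain t where t: "\<bar>t\<bar> \<le> int r" "(x + t) mod int n \<in> int ` D" using dom by blast
        have "(x + t) mod int n \<notin> N (x + j)"
          by (rule notin) (use j n False t in auto)
        moreover have "(x + t) mod int n \<in> N x" using t by (auto simp: N_def)
        ultimately show ?thesis using t by blast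
      qed
    qed
    have sep': "N (int x) \<inter> int ` D \<noteq> N (int y) \<inter> int ` D" if "x < y" "y < n" for x y
    proof (cases "2 * (int y - int x) \<le> int n")
      case True
      then show ?thesis using sep[of "int y - int x" "int x"] that by simp
    next
      case False
      have "N (int y) \<inter> int ` D \<noteq> N (int y + (int n - (int y - int x))) \<inter> int ` D"
        by (rule sep) (use False that in auto)
      moreover have "N (int y + (int n - (int y - int x))) = N (int x)"
        using N_mod[of "int x + int n"] N_mod[of "int x"] by (simp add: add.commute)
      ultimately show ?thesis by blast
    qed
    show "identifying_code (cycle_graph n) r D"
      unfolding identifying_code_def verts
    proof (intro conjI ballI impI)
      show "D \<subseteq> {..<n}" by (rule sub)
      fix x assume "x \<in> {..<n}"
      then have x: "x < n" by simp
      have "N (int x) \<inter> int ` D \<noteq> {}" using dom[of "int x"] by (auto simp: N_def)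
      then show "closed_nbhd (cycle_graph n) r x \<inter> D \<noteq> {}" using N[OF x] by auto
      fix y assume "y \<in> {..<n}" "x \<noteq> y"
      then have y: "y < n" "x \<noteq> y" by simp_all
      have "N (int x) \<inter> int ` D \<noteq> N (int y) \<inter> int ` D"
        using sep'[of x y] sep'[of y x] x y by (metis linorder_neqE_nat)
      then show "closed_nbhd (cycle_graph n) r x \<inter> D \<noteq> closed_nbhd (cycle_graph n) r y \<inter> D"
        using N[OF x] N[OF y(1)] by metis
    qed
  }
qed

section \<open>Residue arithmetic and the counting bound\<close>

lemma mod_if_less_double:
  fixes a n :: int
  assumes "0 \<le> a" "a < 2 * n"
  shows "a mod n = (if a < n then a else a - n)"
proof (cases "a < n")
  case False
  then have "(a - n) mod n = a - n" using assms by (intro mod_pos_pos_trivial) auto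
  then show ?thesis using False by simp
qed (use assms in simp)

lemma inj_on_mod_add: "inj_on (\<lambda>y. (y + s) mod n) {0..<n::int}"
proof (rule inj_onI)
  fix y z assume *: "y \<in> {0..<n}" "z \<in> {0..<n}" "(y + s) mod n = (z + s) mod n"
  then have "y mod n = z mod n" by (metis mod_diff_left_eq add_diff_cancel_right')
  with * show "y = z" by simp
qed

text \<open>Each residue class modulo \<open>g\<close> has \<open>m\<close> elements and is
  preserved by the shift by \<open>s\<close>. Within a class the shift injects the complement of
  \<open>S\<close> into \<open>S\<close>, so \<open>S\<close> holds at least half of the class, and
  oddness of \<open>m\<close> rounds this up. The choice \<open>g = 1\<close> serves the coprime
  case.\<close>

lemma circular_code_card_ge:
  assumes cc: "circular_code n s S" and n: "n = g * m" "g > 0" "m > 0" "odd m" and gs: "g dvd s"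
  shows "g * (m + 1) \<le> 2 * int (card S)"
proof -
  have S: "S \<subseteq> {0..<n}" and cov: "\<And>x. x mod n \<in> S \<or> (x + s) mod n \<in> S"
    using cc by (auto simp: circular_code_def)
  have finS: "finite S" using S finite_subset by blast
  define A where "A c = {y \<in> {0..<n}. y mod g = c}" for c
  have part: "m + 1 \<le> 2 * int (card (A c \<inter> S))" if c: "c \<in> {0..<g}" for c
  proof -
    have finA: "finite (A c)" by (rule finite_subset[of _ "{0..<n}"]) (auto simp: A_def)
    have "bij_betw (\<lambda>i. c + g * i) {0..<m} (A c)"
    proof (rule bij_betwI')
      fix i j assume "i \<in> {0..<m}" "j \<in> {0..<m}"
      show "(c + g * i = c + g * j) = (i = j)" using n by simp
    next
      fix i assume i: "i \<in> {0..<m}"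
      have "g * i \<le> g * (m - 1)" using i n by (intro mult_left_mono) auto
      then have "c + g * i < n" using c n(1) by (simp add: algebra_simps)
      then show "c + g * i \<in> A c" using c i n by (simp add: A_def)
    next
      fix y assume "y \<in> A c"
      then have y: "0 \<le> y" "y < n" "y mod g = c" by (auto simp: A_def)
      have "g * (y div g) + c = y" using y by (metis mult_div_mod_eq)
      moreover have "0 \<le> c" using c by simp
      ultimately have "g * (y div g) < g * m" using y(2) n(1) by linarith
      then have "y div g < m" using n by simp
      then have "y div g \<in> {0..<m}" using y n by (simp add: pos_imp_zdiv_nonneg_iff)
      moreover have "y = c + g * (y div g)" using y by (metis mod_mult_div_eq)
      ultimately show "\<exists>i\<in>{0..<m}. y = c + g * i" by blast
    qed
    then have cardA: "int (card (A c)) = m" using n by (simp flip: bij_betw_same_card)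
    have "card (A c - S) \<le> card (A c \<inter> S)"
    proof (rule card_inj_on_le)
      show "inj_on (\<lambda>y. (y + s) mod n) (A c - S)"
        by (rule inj_on_subset[OF inj_on_mod_add]) (auto simp: A_def)
      show "(\<lambda>y. (y + s) mod n) ` (A c - S) \<subseteq> A c \<inter> S"
      proof (rule image_subsetI)
        fix y assume y: "y \<in> A c - S"
        then have "(y + s) mod n \<in> S" using cov[of y] by (auto simp: A_def)
        moreover have "(y + s) mod n mod g = y mod g"
          using gs n(1) by (metis dvd_triv_left mod_mod_cancel mod_add_right_eq add.right_neutral dvd_imp_mod_0)
        ultimately show "(y + s) mod n \<in> A c \<inter> S" using S y by (auto simp: A_def)
      qed
      show "finite (A c \<inter> S)" using finA by simp
    qed
    moreover have "card (A c) = card (A c \<inter> S) + card (A c - S)"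
      using finA by (metis card_Int_Diff)
    ultimately have "m \<le> 2 * int (card (A c \<inter> S))" using cardA by linarith
    moreover have "m \<noteq> 2 * int (card (A c \<inter> S))" using n(4) by auto
    ultimately show ?thesis by linarith
  qed
  have S_UN: "S = (\<Union>c\<in>{0..<g}. A c \<inter> S)" using S n by (auto simp: A_def)
  have "card (\<Union>c\<in>{0..<g}. A c \<inter> S) = (\<Sum>c\<in>{0..<g}. card (A c \<inter> S))"
    using finS by (intro card_UN_disjoint) (auto simp: A_def)
  then have "card S = (\<Sum>c\<in>{0..<g}. card (A c \<inter> S))" unfolding S_UN[symmetric] .
  then have "2 * int (card S) = (\<Sum>c\<in>{0..<g}. 2 * int (card (A c \<inter> S)))"
    by (simp add: sum_distrib_left)
  also have "\<dots> \<ge> (\<Sum>c\<in>{0..<g}. m + 1)" by (intro sum_mono part)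
  finally show ?thesis using n by simp
qed

section \<open>Minimum codes when the gcd is at least 3\<close>

text \<open>Class \<open>c\<close> modulo \<open>g\<close> is a cycle with points
  \<open>c + s * i\<close>, \<open>i < m\<close>. Class 1 uses the parity opposite to that of its
  neighbours 0 and 2, so two adjacent residues in classes 0, 1 or in classes 1, 2 always include a
  code element. As \<open>s \<ge> g \<ge> 3\<close>, every window contains such a pair.\<close>

lemma circular_code_exists_gcd:
  assumes n: "n = g * m" "m > 0" "odd m" and g: "g = gcd s n" "g \<ge> 3" and s: "s > 0"
  shows "\<exists>S. circular_code n s S \<and> 2 * int (card S) \<le> g * (m + 1)"
proof -
  \<comment> \<open>Index 0 is chosen in every class, because it closes the odd cycle:
    \<open>m - 1\<close> and 0 are adjacent and both even. Either parity rule then selects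
    \<open>(m + 1) / 2\<close> indices.\<close>
  define Q where "Q c i \<longleftrightarrow> i = 0 \<or> (even i \<longleftrightarrow> c \<noteq> 1)" for c i :: int
  define S where "S = (\<Union>c\<in>{0..<g}. (\<lambda>i. (c + s * i) mod n) ` {i \<in> {0..<m}. Q c i})"
  have n0: "n > 0" using n g(2) by (metis mult_pos_pos less_le_trans zero_less_numeral)
  have gs: "g dvd s" using g by simp
  then have "g \<le> s" using s zdvd_imp_le by blast
  have nsm: "n dvd s * m" using gs n(1) by (simp add: mult_dvd_mono)
  have red: "(x + s * (i mod m)) mod n = (x + s * i) mod n" for x i
  proof -
    have "s * i = s * (i mod m) + s * m * (i div m)"
      by (simp add: mult.assoc flip: distrib_left)
    moreover have "n dvd s * m * (i div m)" using nsm by simp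
    ultimately show ?thesis by (simp add: mod_eq_dvd_iff)
  qed
  have S_I: "(c + s * i) mod n \<in> S" if "c \<in> {0..<g}" "Q c (i mod m)" for c i
    unfolding S_def using that n(2) by (intro UN_I[of c] image_eqI[of _ _ "i mod m"]) (simp_all add: red)
  have coord: "\<exists>i. x mod n = (x mod g + s * i) mod n \<and> 0 \<le> i \<and> i < m" for x
  proof -
    \<comment> \<open>Bezout turns the multiple \<open>g * (x div g)\<close> into a multiple of
      \<open>s\<close> modulo \<open>n\<close>, whose factor is the index of \<open>x\<close> in its
      class.\<close>
    obtain a b where ab: "a * s + b * n = g" using bezout_int[of s n] g by metis
    have "x = x mod g + g * (x div g)" by simp
    then have "x = x mod g + s * (a * (x div g)) + n * (b * (x div g))"
      by (subst (asm) (2) ab[symmetric]) (simp add: algebra_simps)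
    then have "x mod n = (x mod g + s * (a * (x div g))) mod n"
      by (metis mod_mult_self2)
    then show ?thesis using red n(2)
      by (intro exI[of _ "a * (x div g) mod m"]) simp
  qed
  have "circular_code n s S" unfolding circular_code_def
  proof (intro conjI allI)
    show "S \<subseteq> {0..<n}" using n0 by (auto simp: S_def)
  next
    fix x
    have pair: "z mod n \<in> S \<or> (z + 1) mod n \<in> S" if z: "z mod g = 0 \<or> z mod g = 1" for z
    proof -
      obtain i where i: "z mod n = (z mod g + s * i) mod n" "0 \<le> i" "i < m" using coord by blast
      have "Q (z mod g) i \<or> Q (z mod g + 1) i" using z by (auto simp: Q_def)
      moreover have "(z + 1) mod n = (z mod g + 1 + s * i) mod n"
        using i(1) by (metis add.assoc add.commute mod_add_left_eq)
      ultimately show ?thesis using S_I[of "z mod g" i] S_I[of "z mod g + 1" i] i z g(2) by auto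
    qed
    \<comment> \<open>\<open>x + j\<close> is the first residue of the window in class 1. It is
      paired with its successor if \<open>j = 0\<close> and with its predecessor otherwise, so that
      the pair stays inside the window.\<close>
    define j where "j = (1 - x) mod g"
    have j: "0 \<le> j" "j < g" "(x + j) mod g = 1" using g(2) by (auto simp: j_def mod_simps)
    show "\<exists>i\<in>{0..<s}. (x + i) mod n \<in> S"
    proof (cases "j = 0")
      case True
      then have "x mod n \<in> S \<or> (x + 1) mod n \<in> S" using j pair by simp
      then show ?thesis using \<open>g \<le> s\<close> g(2) by (auto intro: bexI[of _ 0] bexI[of _ 1])
    next
      case False
      have "(x + (j - 1)) mod g = ((x + j) mod g - 1) mod g" by (simp add: mod_simps algebra_simps)
      then have "(x + (j - 1)) mod g = 0" using j by simp
      from pair[OF disjI1, OF this] have "(x + (j - 1)) mod n \<in> S \<or> (x + j) mod n \<in> S"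
        by (simp add: algebra_simps)
      then show ?thesis using False j \<open>g \<le> s\<close> by (auto intro: bexI[of _ j] bexI[of _ "j - 1"])
    qed
  next
    fix x
    obtain i where i: "x mod n = (x mod g + s * i) mod n" "0 \<le> i" "i < m" using coord by blast
    have xs: "(x + s) mod n = (x mod g + s * (i + 1)) mod n"
      using i(1) by (metis add.assoc distrib_left mod_add_left_eq mult.right_neutral)
    have "Q (x mod g) (i mod m) \<or> Q (x mod g) ((i + 1) mod m)"
      using i by (cases "i + 1 = m") (auto simp: Q_def)
    moreover have "x mod g \<in> {0..<g}" using g(2) by simp
    ultimately show "x mod n \<in> S \<or> (x + s) mod n \<in> S" using i(1) xs S_I by metis
  qed
  moreover have "2 * int (card S) \<le> g * (m + 1)"
  proof -
    obtain h where h: "m = 2 * h + 1" using n(3) by (elim oddE)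
    have h0: "h \<ge> 0" using h n(2) by simp
    have cardQ: "card {i \<in> {0..<m}. Q c i} \<le> nat (h + 1)" for c
    proof (cases "c = 1")
      case True
      have "{i \<in> {0..<m}. Q c i} \<subseteq> (\<lambda>i. if i = 0 then 0 else 2 * i - 1) ` {0..h}"
      proof
        fix i assume "i \<in> {i \<in> {0..<m}. Q c i}"
        then have i: "0 \<le> i" "i < m" "i = 0 \<or> odd i" using True by (auto simp: Q_def)
        then show "i \<in> (\<lambda>i. if i = 0 then 0 else 2 * i - 1) ` {0..h}"
          using h h0 by (intro image_eqI[of _ _ "(i + 1) div 2"]) (auto elim!: oddE)
      qed
      from surj_card_le[OF _ this] show ?thesis using h0 by simp
    next
      case False
      have "{i \<in> {0..<m}. Q c i} \<subseteq> (\<lambda>i. 2 * i) ` {0..h}"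
      proof
        fix i assume "i \<in> {i \<in> {0..<m}. Q c i}"
        then have i: "0 \<le> i" "i < m" "even i" using False by (auto simp: Q_def)
        then show "i \<in> (\<lambda>i. 2 * i) ` {0..h}"
          using h by (intro image_eqI[of _ _ "i div 2"]) auto
      qed
      from surj_card_le[OF _ this] show ?thesis using h0 by simp
    qed
    have "card S \<le> (\<Sum>c\<in>{0..<g}. card ((\<lambda>i. (c + s * i) mod n) ` {i \<in> {0..<m}. Q c i}))"
      unfolding S_def by (rule card_UN_le) simp
    also have "\<dots> \<le> (\<Sum>c\<in>{0..<g}. nat (h + 1))"
    proof (rule sum_mono)
      fix c
      have "card ((\<lambda>i. (c + s * i) mod n) ` {i \<in> {0..<m}. Q c i}) \<le> card {i \<in> {0..<m}. Q c i}"
        by (rule card_image_le, rule finite_subset[of _ "{0..<m}"]) auto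
      with cardQ[of c] show "card ((\<lambda>i. (c + s * i) mod n) ` {i \<in> {0..<m}. Q c i}) \<le> nat (h + 1)"
        by linarith
    qed
    also have "\<dots> = nat (g * (h + 1))" using g(2) h0 by (simp add: nat_mult_distrib)
    finally have "int (card S) \<le> g * (h + 1)" using g(2) h0 by (simp add: le_nat_iff)
    then show ?thesis by (simp add: h algebra_simps)
  qed
  ultimately show ?thesis by blast
qed

section \<open>Coprime case: numbering the single cycle\<close>

context
  fixes n s u :: int
  assumes n_pos: "n > 0" and inverse: "s * u mod n = 1 mod n"
begin

text \<open>Multiplication by \<open>u\<close> numbers the residues along the single cycle: a shift
  by \<open>s\<close> becomes a step by one.\<close>

lemma inverse_index_add: "u * (x + s * j) mod n = (u * x + j) mod n"
proof -
  have "n dvd (s * u - 1) * j" using inverse by (simp add: mod_eq_dvd_iff)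
  then show ?thesis by (simp add: mod_eq_dvd_iff algebra_simps)
qed

text \<open>The code consists of the residues whose index satisfies \<open>P\<close>. Adjacent
  indices correspond to pairs \<open>x\<close>, \<open>x + s\<close>, and multiplication by
  \<open>s\<close> recovers a residue from its index, so there are no more code elements than
  indices. \<open>T\<close> is an explicit superset of these, convenient for counting.\<close>

lemma circular_code_of_indices:
  assumes cover: "\<And>j. 0 \<le> j \<Longrightarrow> j < n \<Longrightarrow> P j \<or> P ((j + 1) mod n)"
    and window: "\<And>x. \<exists>i\<in>{0..<s}. P (u * (x + i) mod n)"
    and sub: "{j \<in> {0..<n}. P j} \<subseteq> T" "finite T"
  shows "\<exists>S. circular_code n s S \<and> card S \<le> card T"
proof (intro exI conjI)
  define S where "S = {x \<in> {0..<n}. P (u * x mod n)}"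
  have mem: "x mod n \<in> S \<longleftrightarrow> P (u * x mod n)" for x
    using n_pos by (simp add: S_def mod_simps)
  show "circular_code n s S"
    unfolding circular_code_def mem
  proof (intro conjI allI)
    show "S \<subseteq> {0..<n}" by (auto simp: S_def)
    show "\<exists>i\<in>{0..<s}. P (u * (x + i) mod n)" for x by (rule window)
    show "P (u * x mod n) \<or> P (u * (x + s) mod n)" for x
      using cover[of "u * x mod n"] inverse_index_add[of x 1] n_pos by (simp add: mod_simps)
  qed
  have "S \<subseteq> (\<lambda>j. s * j mod n) ` {j \<in> {0..<n}. P j}"
  proof
    fix x assume x: "x \<in> S"
    have "s * (u * x mod n) mod n = (s * u mod n) * x mod n"
      by (simp add: mod_simps mult.assoc)
    also have "\<dots> = x" using x by (simp add: inverse mod_simps S_def)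
    finally show "x \<in> (\<lambda>j. s * j mod n) ` {j \<in> {0..<n}. P j}"
      using x n_pos by (intro image_eqI[of _ _ "u * x mod n"]) (auto simp: S_def)
  qed
  then have "card S \<le> card {j \<in> {0..<n}. P j}"
    using finite_subset[OF sub] by (intro surj_card_le)
  also have "\<dots> \<le> card T" using sub by (intro card_mono)
  finally show "card S \<le> card T" .
qed

text \<open>The even indices are taken. In a missed window the index would advance by an even
  \<open>\<delta>\<close> without wraparound, which makes \<open>\<delta>\<close> so small that
  \<open>s * \<delta>\<close>, being congruent to 1, is 1, \<open>n + 1\<close> or
  \<open>1 - n\<close>. Parity excludes the first value, the divisibility hypotheses the other
  two.\<close>

lemma circular_code_exists_coprime:
  assumes n: "n = 2 * k + 1" and s: "s \<ge> 3" "\<not> s dvd n + 1" "\<not> s dvd n - 1"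
  shows "\<exists>S. circular_code n s S \<and> int (card S) \<le> k + 1"
proof -
  have k: "k \<ge> 0" using n n_pos by simp
  have "\<exists>i\<in>{0..<s}. even (u * (x + i) mod n)" for x
  proof (rule ccontr)
    assume "\<not> ?thesis"
    then have odd: "odd (u * (x + i) mod n)" if "0 \<le> i" "i < s" for i using that by auto
    \<comment> \<open>Both endpoints of each step being odd, its length is the even one of \<open>u mod n\<close> and \<open>u mod n - n\<close>.\<close>
    define \<delta> where "\<delta> = (if even (u mod n) then u mod n else u mod n - n)"
    have un: "0 \<le> u mod n" "u mod n < n" using n_pos by simp_all
    have even_\<delta>: "even \<delta>" using n by (auto simp: \<delta>_def)
    \<comment> \<open>The values 0 and \<open>n - 1 = 2k\<close> are even; without them the indices
      spread over at most \<open>n - 3\<close>.\<close>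
    have range: "1 \<le> u * (x + i) mod n \<and> u * (x + i) mod n \<le> n - 2" if "0 \<le> i" "i < s" for i
    proof -
      have "u * (x + i) mod n \<noteq> 0" "u * (x + i) mod n \<noteq> n - 1" using odd[OF that] n by auto
      moreover have "0 \<le> u * (x + i) mod n" "u * (x + i) mod n < n" using n_pos by simp_all
      ultimately show ?thesis by linarith
    qed
    have step: "u * (x + int i) mod n = u * x mod n + int i * \<delta>" if "int i < s" for i
      using that
    proof (induction i)
      case 0
      then show ?case by simp
    next
      case (Suc i)
      let ?y = "u * (x + int i) mod n"
      have y: "0 \<le> ?y" "?y < n" using n_pos by simp_all
      have "u * (x + int (Suc i)) = u * (x + int i) + u" by (simp add: algebra_simps)
      then have "u * (x + int (Suc i)) mod n = (?y + u mod n) mod n" by (simp add: mod_simps)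
      also have "\<dots> = (if ?y + u mod n < n then ?y + u mod n else ?y + u mod n - n)"
        by (intro mod_if_less_double) (use y un in linarith)+
      finally have eq: "u * (x + int (Suc i)) mod n = (if ?y + u mod n < n then ?y + u mod n else ?y + u mod n - n)" .
      have "odd ?y" "odd (u * (x + int (Suc i)) mod n)" using odd Suc.prems by auto
      with eq have "u * (x + int (Suc i)) mod n = ?y + \<delta>"
        using n by (auto simp: \<delta>_def split: if_splits)
      then show ?case using Suc by (simp add: algebra_simps)
    qed
    have "u * (x + (s - 1)) mod n = u * x mod n + (s - 1) * \<delta>"
      using step[of "nat (s - 1)"] s by simp
    then have small: "(s - 1) * \<bar>\<delta>\<bar> \<le> n - 3"
      using range[of 0] range[of "s - 1"] s by (cases "\<delta> \<ge> 0") (auto simp: algebra_simps)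
    \<comment> \<open>The bound concerns \<open>s - 1\<close> steps;
      \<open>2 * s \<le> 3 * (s - 1)\<close>, valid from \<open>s = 3\<close> on, transfers it to
      \<open>s * \<delta>\<close> with enough room to force
      \<open>\<bar>w\<bar> < 2\<close>.\<close>
    have "2 * s * \<bar>\<delta>\<bar> \<le> 3 * (s - 1) * \<bar>\<delta>\<bar>" using s by (intro mult_right_mono) auto
    also have "\<dots> = 3 * ((s - 1) * \<bar>\<delta>\<bar>)" by (rule mult.assoc)
    also have "\<dots> \<le> 3 * (n - 3)" using small by (intro mult_left_mono) auto
    also have "2 * s * \<bar>\<delta>\<bar> = 2 * \<bar>s * \<delta>\<bar>" using s by (simp add: abs_mult)
    finally have bound: "2 * \<bar>s * \<delta>\<bar> \<le> 3 * (n - 3)" .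
    have "\<delta> mod n = u mod n" by (simp add: \<delta>_def)
    then have "s * \<delta> mod n = s * u mod n" by (metis mod_mult_right_eq)
    then have "n dvd s * \<delta> - 1" using inverse by (simp add: mod_eq_dvd_iff)
    then obtain w where w: "s * \<delta> - 1 = n * w" by (elim dvdE)
    have "\<bar>n * w\<bar> \<le> \<bar>s * \<delta>\<bar> + 1" using abs_triangle_ineq4[of "s * \<delta>" 1] by (simp add: w)
    also have "\<dots> < n * 2" using bound n_pos by simp
    finally have "\<bar>n * w\<bar> < n * 2" .
    then have "\<bar>w\<bar> < 2" using n_pos by (simp add: abs_mult)
    then consider "w = 0" | "w = 1" | "w = - 1" by linarith
    then show False
    proof cases
      case 1
      then have "s * \<delta> = 1" using w by simp
      with even_\<delta> show False by (metis even_mult_iff odd_one)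
    next
      case 2
      then have "n + 1 = s * \<delta>" using w by simp
      then show False using s by simp
    next
      case 3
      then have "n - 1 = s * (- \<delta>)" using w by simp
      then show False using s by (metis dvd_triv_left)
    qed
  qed
  moreover have "even j \<or> even ((j + 1) mod n)" if "0 \<le> j" "j < n" for j
    using that n by (cases "j + 1 = n") auto
  moreover have "{j \<in> {0..<n}. even j} \<subseteq> (\<lambda>i. 2 * i) ` {0..k}"
    using n by (auto elim!: evenE)
  ultimately have "\<exists>S. circular_code n s S \<and> card S \<le> card ((\<lambda>i. 2 * i) ` {0..k})"
    by (intro circular_code_of_indices[where P = even]) auto
  moreover have "card ((\<lambda>i. 2 * i) ` {0..k}) \<le> nat (k + 1)"
    using card_image_le[of "{0..k}" "\<lambda>i. 2 * i"] by simp
  ultimately show ?thesis using k by fastforce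
qed

end

section \<open>Coprime case: the exceptional remainders\<close>

context
  fixes n s d e k \<epsilon> :: int
  assumes n: "n = 2 * k + 1" "n = (s - 1) * d + e + 1" and s: "s \<ge> 3"
    and d: "even d" and e: "1 \<le> e" "e \<le> d"
    and eps: "\<epsilon> = 1 \<or> \<epsilon> = - 1" and ds: "d * s mod n = \<epsilon> mod n"
begin

lemma n_bound: "2 * d + e < n" "0 < d"
proof -
  have "2 * d \<le> (s - 1) * d" using s e by (intro mult_right_mono) auto
  then show "2 * d + e < n" using n by simp
  show "0 < d" using e by simp
qed

text \<open>With \<open>k + 1\<close> elements in \<open>S\<close>, the complement and its shift are
  disjoint and fill all residues but one, which forces \<open>S\<close> to alternate along the
  cycle. As \<open>d\<close> inverts \<open>s\<close> up to the sign \<open>\<epsilon>\<close>,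
  consecutive residues have indices differing by the even number \<open>d\<close>, and starting from
  index 1 a whole window is missed.\<close>

lemma no_small_circular_code:
  assumes cc: "circular_code n s S"
  shows "int (card S) \<noteq> k + 1"
proof
  assume cardS: "int (card S) = k + 1"
  have n0: "n > 0" using n_bound e by linarith
  have S: "S \<subseteq> {0..<n}" and cov: "\<And>x. x mod n \<in> S \<or> (x + s) mod n \<in> S"
    and dom: "\<And>x. \<exists>i\<in>{0..<s}. (x + i) mod n \<in> S"
    using cc by (auto simp: circular_code_def)
  define \<sigma> where "\<sigma> y = (y + s) mod n" for y
  define C where "C = {0..<n} - S"
  have \<sigma>_inj: "inj_on \<sigma> {0..<n}" unfolding \<sigma>_def by (rule inj_on_mod_add)
  have C: "C \<subseteq> {0..<n}" "finite C" by (auto simp: C_def)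
  have disj: "C \<inter> \<sigma> ` C = {}"
  proof -
    have "\<sigma> y \<in> S" if "y \<in> C" for y using cov[of y] that by (auto simp: C_def \<sigma>_def)
    then show ?thesis by (auto simp: C_def)
  qed
  have "card C = nat n - card S" unfolding C_def using S by (subst card_Diff_subset) (auto intro: finite_subset)
  then have cardC: "int (card C) = k" using cardS n(1) n0 by (simp add: of_nat_diff)
  have "card (C \<union> \<sigma> ` C) = card C + card (\<sigma> ` C)" using disj C by (intro card_Un_disjoint) auto
  also have "card (\<sigma> ` C) = card C" using \<sigma>_inj C by (intro card_image) (auto intro: inj_on_subset)
  finally have "int (card (C \<union> \<sigma> ` C)) = 2 * k" using cardC by simp
  moreover have sub: "C \<union> \<sigma> ` C \<subseteq> {0..<n}" using C n0 by (auto simp: \<sigma>_def)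
  ultimately have "card ({0..<n} - (C \<union> \<sigma> ` C)) = 1"
    using C n(1) n0 by (subst card_Diff_subset) auto
  then obtain z where z: "{0..<n} - (C \<union> \<sigma> ` C) = {z}" by (auto simp: card_1_singleton_iff)
  then have zC: "z \<notin> C" "0 \<le> z" "z < n" by auto
  \<comment> \<open>A code of the least possible size alternates along the orbit of \<open>\<sigma>\<close> that starts at \<open>z\<close>.\<close>
  have alt: "(z + s * int j) mod n \<in> C \<longleftrightarrow> odd j" if "int j < n" for j
    using that
  proof (induction j)
    case 0
    then show ?case using zC by simp
  next
    case (Suc j)
    define y where "y = (z + s * int j) mod n"
    have y: "y \<in> {0..<n}" using n0 by (simp add: y_def)
    have \<sigma>y: "(z + s * int (Suc j)) mod n = \<sigma> y"
      by (simp add: \<sigma>_def y_def mod_simps algebra_simps)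
    \<comment> \<open>Multiplying by \<open>d\<close> cancels \<open>s\<close> up to sign: a return
      to \<open>z\<close> after \<open>j + 1 < n\<close> steps would make \<open>n\<close> divide
      \<open>j + 1\<close>.\<close>
    have "\<sigma> y \<noteq> z"
    proof
      assume "\<sigma> y = z"
      then have "(z + s * int (Suc j)) mod n = (z + 0) mod n" using \<sigma>y zC by simp
      then have "n dvd s * int (Suc j)" unfolding mod_eq_dvd_iff by simp
      then have "d * (s * int (Suc j)) mod n = 0" by simp
      then have "\<epsilon> * int (Suc j) mod n = 0" using ds by (metis mod_mult_left_eq mult.assoc)
      then have "n dvd int (Suc j)" using eps by (metis dvd_eq_mod_eq_0 dvd_minus_iff mult_1 mult_minus1)
      then show False using Suc.prems zdvd_not_zless[of "int (Suc j)" n] by simp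
    qed
    then have "\<sigma> y \<in> C \<union> \<sigma> ` C" using z n0 by (auto simp: \<sigma>_def)
    moreover have "\<sigma> y \<in> \<sigma> ` C \<longleftrightarrow> y \<in> C"
      using \<sigma>_inj C y by (meson inj_on_image_mem_iff)
    ultimately have "\<sigma> y \<in> C \<longleftrightarrow> y \<notin> C" using disj by blast
    then show ?case using Suc \<sigma>y by (simp add: y_def)
  qed
  have empty: "(z + s + \<epsilon> * i) mod n \<notin> S" if i: "0 \<le> i" "i < s" for i
  proof -
    have "d * i \<le> d * (s - 1)" using i n_bound by (intro mult_left_mono) auto
    \<comment> \<open>The progression starts at 1, not at 0; \<open>e \<ge> 1\<close> leaves just
      the room for that.\<close>
    then have j: "0 \<le> 1 + d * i" "1 + d * i < n" using i n_bound n e by (auto simp: algebra_simps)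
    have "n dvd (d * s - \<epsilon>) * i" using ds by (simp add: mod_eq_dvd_iff)
    then have "(z + s * int (nat (1 + d * i))) mod n = (z + s + \<epsilon> * i) mod n"
      using j by (simp add: mod_eq_dvd_iff algebra_simps)
    then have "(z + s + \<epsilon> * i) mod n \<in> C" using alt[of "nat (1 + d * i)"] j d by (auto simp: even_nat_iff)
    then show ?thesis by (simp add: C_def)
  qed
  show False
  proof (cases "\<epsilon> = 1")
    case True
    then show ?thesis using dom[of "z + s"] empty by auto
  next
    case False
    \<comment> \<open>For \<open>\<epsilon> = - 1\<close> the missed window runs downwards from
      \<open>z + s\<close>, so it begins at \<open>z + s - (s - 1)\<close>, and
      \<open>s - 1 - i\<close> reverses its order.\<close>
    obtain i where "i \<in> {0..<s}" "(z + s - (s - 1) + i) mod n \<in> S" using dom by blast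
    then show ?thesis using empty[of "s - 1 - i"] eps False by (auto simp: algebra_simps)
  qed
qed

text \<open>In indices a window is a progression of \<open>s\<close> terms with step
  \<open>d\<close>, read backwards if \<open>\<epsilon> = - 1\<close>, and \<open>e\<close> is the
  largest start without wraparound. Without wraparound the first or the second term is selected;
  otherwise passing the odd number \<open>n\<close> changes the parity, and a term next to the
  wraparound is selected.\<close>

lemma circular_code_exists_shifted:
  "\<exists>S. circular_code n s S \<and> int (card S) \<le> k + 2"
proof -
  have n0: "n > 0" using n_bound e by linarith
  have "e = 2 * k - (s - 1) * d" using n by simp
  then have even_e: "even e" using d by simp
  \<comment> \<open>The code of even indices misses windows whose indices are odd and increase by \<open>d\<close> without
    wrapping around; each of them meets the interval on which the parity is switched.\<close>
  define P where "P j \<longleftrightarrow> (if d < j \<and> j < d + e then odd j else even j)" for j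
  have progression: "\<exists>i\<in>{0..<s}. P ((a + d * i) mod n)" if a: "0 \<le> a" "a < n" for a
  proof (cases "a + (s - 1) * d < n")
    case True
    then have ae: "a \<le> e" using n by simp
    show ?thesis
    proof (cases "even a")
      case True
      then show ?thesis using a ae e s by (intro bexI[of _ 0]) (auto simp: P_def)
    next
      case False
      then have "a < e" using ae even_e by (cases "a = e") auto
      then show ?thesis using a False e s n_bound d
        by (intro bexI[of _ 1]) (auto simp: P_def)
    qed
  next
    case False
    \<comment> \<open>\<open>a + d * i\<close> is the last term before the wraparound. It is at
      least \<open>n - d > d + e\<close>, and the next term reduces to one below \<open>d\<close>:
      both avoid the switched interval, and exactly one of them is even.\<close>
    define i where "i = (n - 1 - a) div d"
    have i0: "0 \<le> i" using a n_bound by (simp add: i_def pos_imp_zdiv_nonneg_iff)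
    have "d * i + (n - 1 - a) mod d = n - 1 - a" by (simp add: i_def)
    moreover have "0 \<le> (n - 1 - a) mod d" "(n - 1 - a) mod d < d" using n_bound by simp_all
    ultimately have i: "a + d * i < n" "n \<le> a + d * i + d" by linarith+
    have "d * i < d * (s - 1)" using False i by (simp add: algebra_simps)
    then have i_s: "i < s - 1" using n_bound by simp
    show ?thesis
    proof (cases "even a")
      case True
      have "0 \<le> d * i" using i0 n_bound by simp
      then have "P ((a + d * i) mod n)" using True d a i n_bound by (auto simp: P_def)
      then show ?thesis using i0 i_s by (intro bexI[of _ i]) auto
    next
      case False
      have "(a + d * (i + 1)) mod n = (a + d * i + d - n) mod n" by (simp add: algebra_simps)
      also have "\<dots> = a + d * i + d - n" using i n_bound e by (intro mod_pos_pos_trivial) auto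
      finally have "P ((a + d * (i + 1)) mod n)" using False d i n by (auto simp: P_def)
      then show ?thesis using i0 i_s by (intro bexI[of _ "i + 1"]) auto
    qed
  qed
  have "s * (\<epsilon> * d) mod n = (d * s mod n) * \<epsilon> mod n" by (simp add: mod_simps algebra_simps)
  also have "\<dots> = 1 mod n" using eps by (auto simp: ds mod_simps)
  finally have inverse: "s * (\<epsilon> * d) mod n = 1 mod n" .
  have cover: "P j \<or> P ((j + 1) mod n)" if "0 \<le> j" "j < n" for j
  proof (cases "j + 1 = n")
    case True
    then show ?thesis using n_bound by (simp add: P_def)
  next
    case False
    then show ?thesis using that d even_e
      by (cases "j = d"; cases "j + 1 = d + e") (auto simp: P_def)
  qed
  have window: "\<exists>i\<in>{0..<s}. P (\<epsilon> * d * (x + i) mod n)" for x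
  proof (cases "\<epsilon> = 1")
    case True
    obtain i where "i \<in> {0..<s}" "P ((d * x mod n + d * i) mod n)"
      using progression[of "d * x mod n"] n0 by auto
    then show ?thesis using True by (auto simp: mod_simps distrib_left)
  next
    case False
    then have eps': "\<epsilon> = - 1" using eps by simp
    obtain i where "i \<in> {0..<s}" "P ((- d * (x + (s - 1)) mod n + d * i) mod n)"
      using progression[of "- d * (x + (s - 1)) mod n"] n0 by auto
    then show ?thesis
      by (intro bexI[of _ "s - 1 - i"]) (auto simp: eps' mod_simps algebra_simps)
  qed
  \<comment> \<open>\<open>f\<close> lists the selected indices in increasing order. At either end
    of the switched interval two of them are adjacent, hence the offsets -1 and -2; the last one,
    \<open>2k\<close>, is reached at \<open>k + 1\<close>.\<close>
  define f where "f i = (if 2 * i \<le> d then 2 * i else if 2 * i < d + e + 2 then 2 * i - 1 else 2 * i - 2)" for i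
  have sub: "{j \<in> {0..<n}. P j} \<subseteq> f ` {0..k + 1}"
  proof
    fix j assume "j \<in> {j \<in> {0..<n}. P j}"
    then have j: "0 \<le> j" "j \<le> 2 * k" "P j" using n by auto
    consider "j \<le> d" | "d < j" "j < d + e" | "d + e \<le> j" by linarith
    then show "j \<in> f ` {0..k + 1}"
    proof cases
      case 1
      then obtain i where "j = 2 * i" using j by (auto simp: P_def)
      then show ?thesis using 1 j by (intro image_eqI[of _ _ i]) (auto simp: f_def)
    next
      case 2
      then obtain i where "j = 2 * i + 1" using j by (auto simp: P_def elim: oddE)
      then show ?thesis using 2 j even_e d by (intro image_eqI[of _ _ "i + 1"]) (auto simp: f_def)
    next
      case 3
      then obtain i where "j = 2 * i" using j by (auto simp: P_def)
      then show ?thesis using 3 j e by (intro image_eqI[of _ _ "i + 1"]) (auto simp: f_def)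
    qed
  qed
  have "\<exists>S. circular_code n s S \<and> card S \<le> card (f ` {0..k + 1})"
    by (rule circular_code_of_indices[OF n0 inverse cover window sub]) auto
  moreover have "card (f ` {0..k + 1}) \<le> nat (k + 2)"
    using card_image_le[of "{0..k + 1}" f] by simp
  moreover have "k \<ge> 0" using n n0 by simp
  ultimately show ?thesis by fastforce
qed

end

section \<open>Minimum codes of the cycle graph in the three cases\<close>

lemma min_identifying_code_cycle_eqI:
  assumes n: "n \<ge> 4 * r + 3"
    and ex: "\<exists>S. circular_code (int n) (2 * int r + 1) S \<and> card S \<le> m"
    and least: "\<And>S. circular_code (int n) (2 * int r + 1) S \<Longrightarrow> m \<le> card S"
  shows "min_identifying_code (cycle_graph n) r = m"
  unfolding min_identifying_code_def
proof (rule Least_equality)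
  obtain S where S: "circular_code (int n) (2 * int r + 1) S" "card S \<le> m" using ex by blast
  have sub: "S \<subseteq> {0..<int n}" using S(1) by (simp add: circular_code_def)
  then have "int ` nat ` S = S" by (force simp: image_image)
  moreover have "card (int ` nat ` S) = card (nat ` S)" by (intro card_image) simp
  moreover have "finite S" using sub finite_subset by blast
  ultimately have "identifying_code (cycle_graph n) r (nat ` S) \<and> finite (nat ` S) \<and> card (nat ` S) = m"
    using S least[OF S(1)] by (auto simp: identifying_code_cycle_iff[OF n])
  then show "\<exists>D. identifying_code (cycle_graph n) r D \<and> finite D \<and> card D = m" by blast
next
  fix m' assume "\<exists>D. identifying_code (cycle_graph n) r D \<and> finite D \<and> card D = m'"
  then obtain D where D: "circular_code (int n) (2 * int r + 1) (int ` D)" "card D = m'"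
    by (auto simp: identifying_code_cycle_iff[OF n])
  have "card (int ` D) = card D" by (intro card_image) simp
  with least[OF D(1)] D(2) show "m \<le> m'" by simp
qed

text \<open>\<open>g\<close> and its cofactor \<open>m = 2h + 1\<close> divide an odd number, so
  \<open>g \<ge> 3\<close>, and the quotient under the ceiling is \<open>h + 1/2\<close>, which
  rounds up to \<open>(m + 1) / 2\<close>.\<close>

lemma min_identifying_code_cycle_gcd:
  fixes r k :: nat
  defines "g \<equiv> gcd (2 * r + 1) (2 * k + 1)"
  assumes k: "k \<ge> 2 * r + 1" and g: "g \<noteq> 1"
  shows "int (min_identifying_code (cycle_graph (2 * k + 1)) r) =
    int g * \<lceil>real (2 * k + 1) / real (2 * g)\<rceil>"
proof -
  have "g dvd 2 * k + 1" by (simp add: g_def)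
  then obtain m where m: "2 * k + 1 = g * m" by (elim dvdE)
  then have "odd (g * m)" by (metis even_plus_one_iff dvd_triv_left)
  then have odd: "odd g" "odd m" by auto
  then obtain h where h: "m = 2 * h + 1" by (elim oddE)
  have g3: "g \<ge> 3" using odd g by (auto elim!: oddE)
  have "2 * int r + 1 = int (2 * r + 1)" by simp
  then have gi: "int g = gcd (2 * int r + 1) (int (2 * k + 1))" by (simp only: g_def gcd_int_int_eq)
  have mi: "int (2 * k + 1) = int g * int m" using m by (metis of_nat_mult)
  have "min_identifying_code (cycle_graph (2 * k + 1)) r = g * (h + 1)"
  proof (rule min_identifying_code_cycle_eqI)
    have "\<exists>S. circular_code (int (2 * k + 1)) (2 * int r + 1) S \<and> 2 * int (card S) \<le> int g * (int m + 1)"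
      using mi gi g3 odd h by (intro circular_code_exists_gcd) auto
    then obtain S where S: "circular_code (int (2 * k + 1)) (2 * int r + 1) S"
      "2 * int (card S) \<le> int g * (int m + 1)" by blast
    have "int g * (int m + 1) = 2 * int (g * (h + 1))" by (simp add: h algebra_simps)
    with S(2) have "card S \<le> g * (h + 1)" by linarith
    with S(1) show "\<exists>S. circular_code (int (2 * k + 1)) (2 * int r + 1) S \<and> card S \<le> g * (h + 1)" by blast
  next
    fix S assume "circular_code (int (2 * k + 1)) (2 * int r + 1) S"
    then have "int g * (int m + 1) \<le> 2 * int (card S)"
      using mi gi g3 odd h by (intro circular_code_card_ge) auto
    moreover have "int g * (int m + 1) = 2 * int (g * (h + 1))" by (simp add: h algebra_simps)
    ultimately show "g * (h + 1) \<le> card S" by linarith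
  qed (use k in simp)
  moreover have "real (2 * k + 1) / real (2 * g) = real h + 1 / 2"
  proof -
    have "real (2 * k + 1) = real g * real m" using m by (metis of_nat_mult)
    then show ?thesis using g3 by (simp add: h field_simps)
  qed
  moreover have "\<lceil>real h + 1 / 2\<rceil> = int h + 1" by (simp add: ceiling_eq_iff)
  ultimately show ?thesis by (simp only: of_nat_mult of_nat_add of_nat_1)
qed

lemma circular_code_card_ge_coprime:
  assumes "circular_code (2 * k + 1) s S" "k \<ge> 0"
  shows "k + 1 \<le> int (card S)"
  using circular_code_card_ge[OF assms(1), of 1 "2 * k + 1"] assms(2) by simp

text \<open>Modulo \<open>s = 2r + 1\<close> the numbers \<open>n + 1\<close> and
  \<open>n - 1\<close> are \<open>2 * (q + 1)\<close> and \<open>2 * q\<close>. Since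
  \<open>s\<close> is odd and \<open>0 < q < 2r\<close>, it divides neither.\<close>

lemma min_identifying_code_cycle_coprime:
  fixes r k p q :: nat
  assumes r: "r \<ge> 1" and p: "p \<ge> 1" and q: "q \<le> 2 * r" "q \<noteq> 0" "q \<noteq> 2 * r"
    and k: "k = (2 * r + 1) * p + q" and g: "gcd (2 * r + 1) (2 * k + 1) = 1"
  shows "min_identifying_code (cycle_graph (2 * k + 1)) r = k + 1"
proof (rule min_identifying_code_cycle_eqI)
  define s where "s = 2 * int r + 1"
  have "(2 * r + 1) * 1 \<le> (2 * r + 1) * p" using p by (intro mult_left_mono) auto
  then show "4 * r + 3 \<le> 2 * k + 1" using k by simp
  have ki: "int k = s * int p + int q" using k by (simp add: s_def algebra_simps)
  have "s = int (2 * r + 1)" "2 * int k + 1 = int (2 * k + 1)" by (simp_all add: s_def)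
  then have "gcd s (2 * int k + 1) = int (gcd (2 * r + 1) (2 * k + 1))" by (simp only: gcd_int_int_eq)
  then obtain u v where "u * s + v * (2 * int k + 1) = 1" using g bezout_int[of s "2 * int k + 1"] by auto
  then have "s * u - 1 = (2 * int k + 1) * (- v)" by (simp add: algebra_simps)
  then have "s * u mod (2 * int k + 1) = 1 mod (2 * int k + 1)" by (metis mod_eq_dvd_iff dvd_triv_left)
  moreover have "\<not> s dvd 2 * int k + 1 + 1"
  proof
    assume "s dvd 2 * int k + 1 + 1"
    moreover have "2 * int k + 1 + 1 = s * (2 * int p) + 2 * (int q + 1)" using ki by (simp add: algebra_simps)
    ultimately have "s dvd 2 * (int q + 1)" by (metis dvd_add_right_iff dvd_triv_left)
    moreover have "coprime s 2" by (simp add: s_def)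
    ultimately have "s dvd int q + 1" by (metis coprime_dvd_mult_right_iff)
    then have "s \<le> int q + 1" by (intro zdvd_imp_le) auto
    with q show False by (simp add: s_def)
  qed
  moreover have "\<not> s dvd 2 * int k + 1 - 1"
  proof
    assume "s dvd 2 * int k + 1 - 1"
    moreover have "2 * int k + 1 - 1 = s * (2 * int p) + 2 * int q" using ki by (simp add: algebra_simps)
    ultimately have "s dvd 2 * int q" by (metis dvd_add_right_iff dvd_triv_left)
    moreover have "coprime s 2" by (simp add: s_def)
    ultimately have "s dvd int q" by (metis coprime_dvd_mult_right_iff)
    then have "s \<le> int q" using q by (intro zdvd_imp_le) auto
    with q show False by (simp add: s_def)
  qed
  ultimately have "\<exists>S. circular_code (2 * int k + 1) s S \<and> int (card S) \<le> int k + 1"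
    using r by (intro circular_code_exists_coprime) (auto simp: s_def)
  then show "\<exists>S. circular_code (int (2 * k + 1)) (2 * int r + 1) S \<and> card S \<le> k + 1"
    by (auto simp: s_def add.commute)
next
  fix S assume "circular_code (int (2 * k + 1)) (2 * int r + 1) S"
  then have "circular_code (2 * int k + 1) (2 * int r + 1) S" by (simp add: add.commute)
  from circular_code_card_ge_coprime[OF this] show "k + 1 \<le> card S" by simp
qed

lemma min_identifying_code_cycle_coprime_extreme:
  fixes r k p q :: nat
  assumes r: "r \<ge> 1" and p: "p \<ge> 1" and q: "q = 0 \<or> q = 2 * r"
    and k: "k = (2 * r + 1) * p + q"
  shows "min_identifying_code (cycle_graph (2 * k + 1)) r = k + 2"
proof (rule min_identifying_code_cycle_eqI)
  define s where "s = 2 * int r + 1"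
  \<comment> \<open>For \<open>q = 0\<close>, \<open>n - 1 = 2k = s * 2p\<close>; for
    \<open>q = 2r\<close>, \<open>n + 1 = 2k + 2 = s * (2p + 2)\<close>. Thus \<open>d\<close> is
    the quotient, \<open>\<epsilon>\<close> the resulting sign, and \<open>2p\<close> serves as
    \<open>e\<close> in both cases.\<close>
  define d where "d = (if q = 0 then 2 * int p else 2 * int p + 2)"
  define \<epsilon> :: int where "\<epsilon> = (if q = 0 then - 1 else 1)"
  have "(2 * r + 1) * 1 \<le> (2 * r + 1) * p" using p by (intro mult_left_mono) auto
  then show "4 * r + 3 \<le> 2 * k + 1" using k by simp
  have n: "2 * int k + 1 = d * s - \<epsilon>"
    using k q r by (auto simp: s_def d_def \<epsilon>_def algebra_simps)
  have n': "2 * int k + 1 = (s - 1) * d + 2 * int p + 1"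
    using n by (auto simp: d_def \<epsilon>_def algebra_simps)
  have ds: "d * s mod (2 * int k + 1) = \<epsilon> mod (2 * int k + 1)"
    unfolding mod_eq_dvd_iff n[symmetric] by simp
  have s: "s \<ge> 3" using r by (simp add: s_def)
  have d: "even d" "1 \<le> 2 * int p" "2 * int p \<le> d" "\<epsilon> = 1 \<or> \<epsilon> = - 1"
    using p by (auto simp: d_def \<epsilon>_def)
  note facts = refl n' s d ds
  show "\<exists>S. circular_code (int (2 * k + 1)) (2 * int r + 1) S \<and> card S \<le> k + 2"
    using circular_code_exists_shifted[OF facts] by (auto simp: s_def add.commute)
  show "k + 2 \<le> card S" if "circular_code (int (2 * k + 1)) (2 * int r + 1) S" for S
  proof -
    have cc: "circular_code (2 * int k + 1) s S" using that by (simp add: s_def add.commute)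
    show ?thesis
      using circular_code_card_ge_coprime[OF cc] no_small_circular_code[OF facts cc] by simp
  qed
qed

theorem theorem3:
  fixes r k p q :: nat
  assumes "r \<ge> 1"
    and "p \<ge> 1"
    and "q \<in> {0..2 * r}"
    and "k = (2 * r + 1) * p + q"
  shows "(gcd (2 * r + 1) (2 * k + 1) \<noteq> 1 \<longrightarrow>
      int (min_identifying_code (with_proj (cycle_graph (2 * k + 1))) r) =
        int (gcd (2 * r + 1) (2 * k + 1)) *
          \<lceil>real (2 * k + 1) / real (2 * gcd (2 * r + 1) (2 * k + 1))\<rceil>) \<and>
    (gcd (2 * r + 1) (2 * k + 1) = 1 \<and> q \<in> {0, 2 * r} \<longrightarrow>
      min_identifying_code (with_proj (cycle_graph (2 * k + 1))) r = k + 2) \<and>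
    (gcd (2 * r + 1) (2 * k + 1) = 1 \<and> q \<notin> {0, 2 * r} \<longrightarrow>
      min_identifying_code (with_proj (cycle_graph (2 * k + 1))) r = k + 1)"
proof (intro conjI impI)
  \<comment> \<open>\<open>p \<ge> 1\<close> makes the cycle have at least \<open>4r + 3\<close>
    vertices, as the translation into residues demands.\<close>
  have "(2 * r + 1) * 1 \<le> (2 * r + 1) * p" using assms(2) by (intro mult_left_mono) auto
  then have k: "k \<ge> 2 * r + 1" using assms(4) by simp
  show "int (min_identifying_code (cycle_graph (2 * k + 1)) r) =
      int (gcd (2 * r + 1) (2 * k + 1)) *
        \<lceil>real (2 * k + 1) / real (2 * gcd (2 * r + 1) (2 * k + 1))\<rceil>"
    if "gcd (2 * r + 1) (2 * k + 1) \<noteq> 1"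
    using min_identifying_code_cycle_gcd[OF k that] .
  show "min_identifying_code (cycle_graph (2 * k + 1)) r = k + 2"
    if "gcd (2 * r + 1) (2 * k + 1) = 1 \<and> q \<in> {0, 2 * r}"
    using min_identifying_code_cycle_coprime_extreme[of r p q k] assms that by auto
  show "min_identifying_code (cycle_graph (2 * k + 1)) r = k + 1"
    if "gcd (2 * r + 1) (2 * k + 1) = 1 \<and> q \<notin> {0, 2 * r}"
    using min_identifying_code_cycle_coprime[of r p q k] assms that by auto
qed

end
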